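(* Let $\alpha>1$. Let $\mu_1,\mu_2,\mu_3$ be $\alpha$-Frostman measures supported on pairwise separated compact sets $E_1,E_2,E_3\subset\mathbb R^2$, respectively. Then $$(\mu_1\times\mu_2)\Big(\big\{(x_1,x_2)\in E_1\times E_2: (\rho_{\pi_{x_1}(x_2)^\perp})_*\mu_3\in L^2(\mathbb R)\big\}\Big)>0.$$ In fact, this set has full $\mu_1\times\mu_2$ measure in $E_1\times E_2$.
   Context: An $\alpha$-Frostman measure on a compact set $E\subset\mathbb R^2$ is a nonzero finite Borel measure $\mu$ supported on $E$ for which there is a constant $C$ with $\mu(B(x,r))\le Cr^\alpha$ for all $x\in\mathbb R^2$, $r>0$. Sets are pairwise separated if any two are at positive distance. For $x_1\in\mathbb R^2$, the radial projection is $\pi_{x_1}:\mathbb R^2\setminus\{x_1\}\to\mathbb S^1$, $\pi_{x_1}(y)=\frac{y-x_1}{|y-x_1|}$. For a unit vector $\theta\in\mathbb S^1$, $\rho_\theta:\mathbb R^2\to\mathbb R$ is $\rho_\theta(y)=y\cdot\theta$, and $\theta^\perp$ denotes the unit vector obtained by rotating $\theta$ by $\pi/2$. $f_*\mu$ denotes pushforward; a measure on $\mathbb R$ is in $L^2(\mathbb R)$ if it is absolutely continuous with respect to Lebesgue measure with density in $L^2(\mathbb R)$. *)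

theory Defs
  imports "HOL-Analysis.Analysis"
begin

text \<open>
  A measure on the Borel sets is called supported on a closed set when the
  complement of that set is null; the plane is second countable, so this is the inclusion of
  the topological support.
\<close>
definition frostman_measure :: "real \<Rightarrow> (real^2) set \<Rightarrow> (real^2) measure \<Rightarrow> bool" where
  "frostman_measure \<alpha> E \<mu> \<longleftrightarrow>
     sets \<mu> = sets borel \<and>
     finite_measure \<mu> \<and>
     emeasure \<mu> UNIV > 0 \<and>
     emeasure \<mu> (UNIV - E) = 0 \<and>
     (\<exists>C::real. \<forall>x r. r > 0 \<longrightarrow> measure \<mu> (ball x r) \<le> C * r powr \<alpha>)"

text \<open>
  Since \<^const>\<open>setdist\<close> is \<open>0\<close> when an argument is empty, this excludes empty sets;
  sets carrying a nonzero measure are nonempty anyway.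
\<close>
definition separated_sets :: "(real^2) set \<Rightarrow> (real^2) set \<Rightarrow> bool" where
  "separated_sets A B \<longleftrightarrow> setdist A B > 0"

definition radial_proj :: "real^2 \<Rightarrow> real^2 \<Rightarrow> real^2" where
  "radial_proj x y = (1 / norm (y - x)) *\<^sub>R (y - x)"

definition rot90 :: "real^2 \<Rightarrow> real^2" where
  "rot90 \<theta> = vector [- \<theta> $ 2, \<theta> $ 1]"

definition lin_proj :: "real^2 \<Rightarrow> real^2 \<Rightarrow> real" where
  "lin_proj \<theta> y = y \<bullet> \<theta>"

definition measure_in_L2 :: "real measure \<Rightarrow> bool" where
  "measure_in_L2 \<nu> \<longleftrightarrow>
     (\<exists>f :: real \<Rightarrow> real. f \<in> borel_measurable borel \<and> (\<forall>t. 0 \<le> f t) \<and>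
        \<nu> = density lborel (\<lambda>t. ennreal (f t)) \<and>
        integrable lborel (\<lambda>t. (f t)\<^sup>2))"

text \<open>
  \<^const>\<open>emeasure\<close> takes the value \<open>0\<close> on non-measurable sets, so a
  claim that this set has positive measure includes its measurability.
\<close>
definition good_pairs ::
    "(real^2) set \<Rightarrow> (real^2) set \<Rightarrow> (real^2) measure \<Rightarrow> ((real^2) \<times> (real^2)) set" where
  "good_pairs E1 E2 \<mu>3 =
     {(x1, x2). (x1, x2) \<in> E1 \<times> E2 \<and>
        measure_in_L2 (distr \<mu>3 borel (lin_proj (rot90 (radial_proj x1 x2))))}"

end

theory Submission
  imports Defs
begin

text \<open>
  For a direction \<open>v\<close> let \<open>E\<^sub>i(v)\<close> be the squared \<open>L\<^sup>2\<close> norm of the projection of \<open>\<mu>\<^sub>i\<close> along \<open>v\<close>.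
  Averaging over \<open>v\<close> bounds the integral of \<open>E\<^sub>i\<close> by the Riesz 1-energy of \<open>\<mu>\<^sub>i\<close>, which is finite
  because \<open>\<alpha> > 1\<close>; so \<open>E\<^sub>3\<close> is infinite only on a null set of directions. It remains to see
  that the direction of \<open>x\<^sub>1 - x\<^sub>2\<close> under \<open>\<mu>\<^sub>1 \<times> \<mu>\<^sub>2\<close> has an absolutely continuous law. At every scale
  its mollified density at \<open>v\<close> is an inner product of mollified projections of \<open>\<mu>\<^sub>1\<close> and \<open>\<mu>\<^sub>2\<close>,
  hence at most \<open>E\<^sub>1(v) + E\<^sub>2(v)\<close>, an integrable function independent of the scale.

  Mollifying by averages over intervals of length \<open>2\<^sup>-\<^sup>n\<close> makes the approximate norms increase in \<open>n\<close>,
  so that \<open>E\<^sub>i\<close> is a supremum; it is then Borel in \<open>v\<close> and finite exactly when the projection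
  has a square-integrable density.
\<close>

section \<open>Dyadic averages of measures on the line\<close>

text \<open>This is the density at t of the convolution of M with the uniform law on
  \<open>{- 1 / 2 ^ n<..0}\<close>. Half-open windows are used because they split exactly into two
  windows of half the length.\<close>

definition dyadic_avg :: "real measure \<Rightarrow> nat \<Rightarrow> real \<Rightarrow> ennreal" where
  "dyadic_avg M n t = 2 ^ n * emeasure M {t..<t + 1 / 2 ^ n}"

text \<open>The autocorrelation of the normalised indicator of an interval of length \<open>1 / 2 ^ n\<close>.\<close>
definition tent :: "nat \<Rightarrow> real \<Rightarrow> ennreal" where
  "tent n u = ennreal (4 ^ n * max 0 (1 / 2 ^ n - \<bar>u\<bar>))"

lemma tent_measurable [measurable]: "tent n \<in> borel_measurable borel"
  unfolding tent_def by measurable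

lemma measurable_window [measurable (raw)]:
  assumes [measurable]: "f \<in> borel_measurable M" "g \<in> borel_measurable M"
  shows "(\<lambda>x. indicator {f x..<f x + (d::real)} (g x) :: ennreal) \<in> borel_measurable M"
proof -
  have "(\<lambda>x. indicator {f x..<f x + d} (g x) :: ennreal) = (\<lambda>x. if f x \<le> g x \<and> g x < f x + d then 1 else 0)"
    by (auto simp: indicator_def fun_eq_iff)
  then show ?thesis by simp
qed

lemma dyadic_avg_eq:
  assumes [simp]: "sets M = sets borel"
  shows "dyadic_avg M n t = (\<integral>\<^sup>+x. 2 ^ n * indicator {t..<t + 1 / 2 ^ n} x \<partial>M)"
  unfolding dyadic_avg_def by (subst nn_integral_cmult_indicator) auto

lemma dyadic_avg_measurable [measurable]:
  assumes [measurable_cong]: "sets M = sets borel" and "finite_measure M"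
  shows "dyadic_avg M n \<in> borel_measurable borel"
proof -
  interpret finite_measure M by fact
  show ?thesis
    unfolding dyadic_avg_eq[OF assms(1), abs_def] by measurable
qed

text \<open>Writing each average as an integral of a window indicator and applying Tonelli, the
  integration in t leaves \<open>4 ^ n\<close> times the length of the overlap of two windows, which
  is the tent.\<close>

lemma nn_integral_dyadic_avg_mult:
  assumes [measurable_cong]: "sets M = sets borel" "sets N = sets borel"
    and "finite_measure M" "finite_measure N"
  shows "(\<integral>\<^sup>+t. dyadic_avg M n t * dyadic_avg N n t \<partial>lborel) = (\<integral>\<^sup>+x. \<integral>\<^sup>+y. tent n (x - y) \<partial>N \<partial>M)"
proof -
  interpret M: finite_measure M by fact
  interpret N: finite_measure N by fact
  interpret LM: pair_sigma_finite lborel M by unfold_locales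
  interpret LN: pair_sigma_finite lborel N by unfold_locales
  let ?d = "1 / 2 ^ n :: real"
  let ?I = "\<lambda>t x. 2 ^ n * indicator {t..<t + ?d} x :: ennreal"
  have overlap: "(\<integral>\<^sup>+t. ?I t x * ?I t y \<partial>lborel) = tent n (x - y)" for x y
  proof -
    \<comment> \<open>A window starting at t contains both x and y exactly when t lies in a
      half-open interval that is empty or has length \<open>?d - \<bar>x - y\<bar>\<close>.\<close>
    have "(\<integral>\<^sup>+t. ?I t x * ?I t y \<partial>lborel) = (\<integral>\<^sup>+t. 4 ^ n * indicator {max x y - ?d<..min x y} t \<partial>lborel)"
    proof (intro nn_integral_cong)
      fix t
      have "(2 ^ n * 2 ^ n :: ennreal) = 4 ^ n"
        by (simp flip: power_mult_distrib)
      then show "?I t x * ?I t y = 4 ^ n * indicator {max x y - ?d<..min x y} t"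
        by (auto simp: indicator_def)
    qed
    also have "\<dots> = 4 ^ n * emeasure lborel {max x y - ?d<..min x y}"
      by (subst nn_integral_cmult_indicator) auto
    also have "emeasure lborel {max x y - ?d<..min x y} = ennreal (max 0 (?d - \<bar>x - y\<bar>))"
    proof (cases "max x y - ?d \<le> min x y")
      case True
      then show ?thesis by (auto simp: max_def min_def intro!: arg_cong[where f=ennreal])
    next
      case False
      then have "{max x y - ?d<..min x y} = {}" by auto
      then show ?thesis using False by (auto simp: max_def min_def split: if_splits)
    qed
    also have "4 ^ n * ennreal (max 0 (?d - \<bar>x - y\<bar>)) = tent n (x - y)"
      unfolding tent_def by (subst ennreal_mult) (auto simp flip: ennreal_power)
    finally show ?thesis .
  qed
  have "(\<integral>\<^sup>+t. dyadic_avg M n t * dyadic_avg N n t \<partial>lborel)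
      = (\<integral>\<^sup>+t. \<integral>\<^sup>+x. \<integral>\<^sup>+y. ?I t x * ?I t y \<partial>N \<partial>M \<partial>lborel)"
    unfolding dyadic_avg_eq[OF assms(1)] dyadic_avg_eq[OF assms(2)]
    by (simp add: nn_integral_cmult nn_integral_multc)
  also have "\<dots> = (\<integral>\<^sup>+x. \<integral>\<^sup>+t. \<integral>\<^sup>+y. ?I t x * ?I t y \<partial>N \<partial>lborel \<partial>M)"
    by (subst LM.Fubini') measurable
  also have "\<dots> = (\<integral>\<^sup>+x. \<integral>\<^sup>+y. \<integral>\<^sup>+t. ?I t x * ?I t y \<partial>lborel \<partial>N \<partial>M)"
    by (intro nn_integral_cong LN.Fubini'[symmetric]) measurable
  finally show ?thesis by (simp add: overlap)
qed

section \<open>Monotonicity of the dyadic energies\<close>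

definition dyadic_energy :: "real measure \<Rightarrow> nat \<Rightarrow> ennreal" where
  "dyadic_energy M n = (\<integral>\<^sup>+t. (dyadic_avg M n t)\<^sup>2 \<partial>lborel)"

lemma dyadic_avg_Suc:
  assumes [simp]: "sets M = sets borel"
  shows "2 * dyadic_avg M n t = dyadic_avg M (Suc n) t + dyadic_avg M (Suc n) (t + 1 / 2 ^ Suc n)"
proof -
  have "{t..<t + 1 / 2 ^ n} = {t..<t + 1 / 2 ^ Suc n} \<union> {t + 1 / 2 ^ Suc n..<t + 1 / 2 ^ Suc n + 1 / 2 ^ Suc n}"
    by (subst ivl_disj_un) (auto simp: field_simps)
  then have "emeasure M {t..<t + 1 / 2 ^ n} = emeasure M {t..<t + 1 / 2 ^ Suc n}
      + emeasure M {t + 1 / 2 ^ Suc n..<t + 1 / 2 ^ Suc n + 1 / 2 ^ Suc n}"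
    by (simp add: plus_emeasure del: power_Suc)
  then show ?thesis
    unfolding dyadic_avg_def by (simp add: distrib_left mult.assoc)
qed

lemma ennreal_mult_le_sum_squares: "a * b \<le> a\<^sup>2 + (b :: ennreal)\<^sup>2"
proof (cases "a \<le> b")
  case True
  then have "a * b \<le> b\<^sup>2" by (simp add: power2_eq_square mult_right_mono)
  then show ?thesis by (simp add: add_increasing)
next
  case False
  then have "a * b \<le> a\<^sup>2" by (simp add: power2_eq_square mult_left_mono)
  then show ?thesis by (simp add: add_increasing2)
qed

text \<open>Convexity of the square at a midpoint, that is \<open>0 \<le> (x - y)\<^sup>2\<close>.
  Finiteness allows the argument to be carried out in the reals.\<close>

lemma ennreal_parallelogram_le:
  assumes "2 * c = a + (b::ennreal)" "a < top" "b < top"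
  shows "2 * c\<^sup>2 \<le> a\<^sup>2 + b\<^sup>2"
proof -
  have "2 * c < top" unfolding assms(1) using assms(2,3) by (simp add: ennreal_add_eq_top less_top)
  then have "c < top" by (auto simp: ennreal_mult_less_top)
  then obtain x y z where *: "a = ennreal x" "b = ennreal y" "c = ennreal z" "0 \<le> x" "0 \<le> y" "0 \<le> z"
    using assms(2,3) by (metis less_top_ennreal)
  have "2 * z = x + y"
  proof -
    have "ennreal (2 * z) = ennreal (x + y)"
      using assms(1) * by (simp add: ennreal_mult ennreal_plus)
    then show ?thesis using * by (subst (asm) ennreal_inj) auto
  qed
  then have z: "z = (x + y) / 2" by simp
  have "0 \<le> (x - y)\<^sup>2" by simp
  then have "2 * z\<^sup>2 \<le> x\<^sup>2 + y\<^sup>2"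
    unfolding z by (simp add: power2_eq_square field_simps)
  then have "ennreal (2 * z\<^sup>2) \<le> ennreal (x\<^sup>2 + y\<^sup>2)" by (rule ennreal_leI)
  then show ?thesis using * by (simp add: ennreal_mult ennreal_plus ennreal_power)
qed

lemma nn_integral_lborel_shift:
  assumes [measurable]: "f \<in> borel_measurable borel"
  shows "(\<integral>\<^sup>+t. f (t + c :: real) \<partial>lborel) = (\<integral>\<^sup>+t. f t \<partial>lborel)"
  by (subst nn_integral_real_affine[where c=1 and t=c and f=f]) (auto simp: add.commute)

text \<open>Halving each window makes a coarse average the mean of a finer average and a translate
  of it. Convexity of the square and translation invariance of Lebesgue measure then compare the
  energies.\<close>

lemma incseq_dyadic_energy:
  assumes [measurable_cong]: "sets M = sets borel" and "finite_measure M"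
  shows "incseq (dyadic_energy M)"
proof (rule incseq_SucI)
  fix n
  interpret finite_measure M by fact
  note [measurable] = dyadic_avg_measurable[OF assms]
  let ?f = "dyadic_avg M (Suc n)"
  have fin: "dyadic_avg M k t < top" for k t
    unfolding dyadic_avg_def by (simp add: ennreal_mult_eq_top_iff power_eq_top_ennreal flip: less_top)
  have "2 * dyadic_energy M n = (\<integral>\<^sup>+t. 2 * (dyadic_avg M n t)\<^sup>2 \<partial>lborel)"
    unfolding dyadic_energy_def by (simp add: nn_integral_cmult)
  also have "\<dots> \<le> (\<integral>\<^sup>+t. (?f t)\<^sup>2 + (?f (t + 1 / 2 ^ Suc n))\<^sup>2 \<partial>lborel)"
    by (intro nn_integral_mono ennreal_parallelogram_le dyadic_avg_Suc assms fin)
  also have "\<dots> = (\<integral>\<^sup>+t. (?f t)\<^sup>2 \<partial>lborel) + (\<integral>\<^sup>+t. (?f (t + 1 / 2 ^ Suc n))\<^sup>2 \<partial>lborel)"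
    by (rule nn_integral_add) measurable
  also have "(\<integral>\<^sup>+t. (?f (t + 1 / 2 ^ Suc n))\<^sup>2 \<partial>lborel) = (\<integral>\<^sup>+t. (?f t)\<^sup>2 \<partial>lborel)"
    by (rule nn_integral_lborel_shift[where f="\<lambda>t. (?f t)\<^sup>2"]) measurable
  finally have "2 * dyadic_energy M n \<le> 2 * dyadic_energy M (Suc n)"
    by (simp add: dyadic_energy_def mult_2)
  then show "dyadic_energy M n \<le> dyadic_energy M (Suc n)"
    by (simp add: ennreal_mult_le_mult_iff)
qed

section \<open>Bounded dyadic energy and square-integrable densities\<close>

lemma ennreal_power2_eq: "(2::ennreal) ^ n = ennreal (2 ^ n)"
  by (simp flip: ennreal_power)

lemma ennreal_power2_mult_inverse: "2 ^ n * ennreal (1 / 2 ^ n) = 1"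
  by (simp add: ennreal_power2_eq flip: ennreal_mult')

text \<open>Averaging is a contraction of L^2: Cauchy-Schwarz on each window, followed by
  Tonelli.\<close>

lemma dyadic_energy_le_of_density:
  fixes f :: "real \<Rightarrow> real"
  assumes [measurable]: "f \<in> borel_measurable borel" and "\<And>t. 0 \<le> f t"
    and M: "M = density lborel (\<lambda>t. ennreal (f t))"
  shows "dyadic_energy M n \<le> (\<integral>\<^sup>+t. ennreal ((f t)\<^sup>2) \<partial>lborel)"
proof -
  let ?d = "1 / 2 ^ n :: real"
  let ?I = "\<lambda>t x. indicator {t..<t + ?d} x :: ennreal"
  have d: "2 ^ n * ennreal ?d = 1"
    by (rule ennreal_power2_mult_inverse)
  have avg: "(dyadic_avg M n t)\<^sup>2 \<le> (\<integral>\<^sup>+x. 2 ^ n * (ennreal ((f x)\<^sup>2) * ?I t x) \<partial>lborel)" for t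
  proof -
    \<comment> \<open>Repeating the indicator exhibits the integrand as a product of two functions
      living on the window, ready for Cauchy-Schwarz.\<close>
    have "emeasure M {t..<t + ?d} = (\<integral>\<^sup>+x. (ennreal (f x) * ?I t x) * ?I t x \<partial>lborel)"
      unfolding M by (subst emeasure_density) (auto intro!: nn_integral_cong simp: indicator_def)
    then have "(emeasure M {t..<t + ?d})\<^sup>2
        \<le> (\<integral>\<^sup>+x. (ennreal (f x) * ?I t x)\<^sup>2 \<partial>lborel) * (\<integral>\<^sup>+x. (?I t x)\<^sup>2 \<partial>lborel)"
      by (simp only:) (rule Cauchy_Schwarz_nn_integral; measurable)
    also have "(\<integral>\<^sup>+x. (?I t x)\<^sup>2 \<partial>lborel) = (\<integral>\<^sup>+x. ?I t x \<partial>lborel)"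
      by (intro nn_integral_cong) (auto simp: indicator_def)
    also have "\<dots> = ennreal ?d" by simp
    also have "(\<integral>\<^sup>+x. (ennreal (f x) * ?I t x)\<^sup>2 \<partial>lborel) = (\<integral>\<^sup>+x. ennreal ((f x)\<^sup>2) * ?I t x \<partial>lborel)"
      using assms(2) by (intro nn_integral_cong) (auto simp: indicator_def ennreal_power)
    finally have "(2 ^ n)\<^sup>2 * (emeasure M {t..<t + ?d})\<^sup>2
        \<le> (2 ^ n)\<^sup>2 * ((\<integral>\<^sup>+x. ennreal ((f x)\<^sup>2) * ?I t x \<partial>lborel) * ennreal ?d)"
      by (rule mult_left_mono) simp
    also have "\<dots> = 2 ^ n * (\<integral>\<^sup>+x. ennreal ((f x)\<^sup>2) * ?I t x \<partial>lborel) * (2 ^ n * ennreal ?d)"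
      by (simp add: power2_eq_square mult_ac)
    also have "\<dots> = (\<integral>\<^sup>+x. 2 ^ n * (ennreal ((f x)\<^sup>2) * ?I t x) \<partial>lborel)"
      unfolding d by (simp add: nn_integral_cmult)
    finally show ?thesis by (simp add: dyadic_avg_def power_mult_distrib)
  qed
  have "dyadic_energy M n \<le> (\<integral>\<^sup>+t. \<integral>\<^sup>+x. 2 ^ n * (ennreal ((f x)\<^sup>2) * ?I t x) \<partial>lborel \<partial>lborel)"
    unfolding dyadic_energy_def by (intro nn_integral_mono avg)
  also have "\<dots> = (\<integral>\<^sup>+x. \<integral>\<^sup>+t. 2 ^ n * (ennreal ((f x)\<^sup>2) * ?I t x) \<partial>lborel \<partial>lborel)"
    by (subst lborel_pair.Fubini') measurable
  also have "\<dots> = (\<integral>\<^sup>+x. ennreal ((f x)\<^sup>2) \<partial>lborel)"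
  proof (intro nn_integral_cong)
    fix x
    have "(\<integral>\<^sup>+t. 2 ^ n * (ennreal ((f x)\<^sup>2) * ?I t x) \<partial>lborel)
        = (\<integral>\<^sup>+t. (2 ^ n * ennreal ((f x)\<^sup>2)) * indicator {x - ?d<..x} t \<partial>lborel)"
      by (intro nn_integral_cong) (auto simp: indicator_def)
    also have "\<dots> = (2 ^ n * ennreal ((f x)\<^sup>2)) * ennreal ?d"
      by (subst nn_integral_cmult_indicator) auto
    also have "\<dots> = ennreal ((f x)\<^sup>2) * (2 ^ n * ennreal ?d)" by (simp only: mult_ac)
    finally show "(\<integral>\<^sup>+t. 2 ^ n * (ennreal ((f x)\<^sup>2) * ?I t x) \<partial>lborel) = ennreal ((f x)\<^sup>2)"
      unfolding d by simp
  qed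
  finally show ?thesis .
qed

lemma eventually_less_inverse_power2:
  assumes "0 < (e::real)" shows "eventually (\<lambda>n. 1 / 2 ^ n < e) sequentially"
proof -
  have "(\<lambda>n. 1 / 2 ^ n :: real) \<longlonglongrightarrow> 0"
    using LIMSEQ_realpow_zero[of "1/2::real"] by (simp add: power_one_over)
  then show ?thesis using assms by (rule order_tendstoD)
qed

text \<open>The weight \<open>?w n x\<close> is the proportion of windows containing x that start in
  U. For x in the open set U it is eventually 1, so Fatou and Tonelli give the bound.\<close>

lemma emeasure_open_le_liminf_dyadic_avg:
  assumes [measurable_cong]: "sets M = sets borel" and "finite_measure M" and "open U"
  shows "emeasure M U \<le> liminf (\<lambda>n. \<integral>\<^sup>+t. indicator U t * dyadic_avg M n t \<partial>lborel)"
proof -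
  interpret M: finite_measure M by fact
  interpret LM: pair_sigma_finite lborel M by unfold_locales
  have [measurable]: "U \<in> sets borel" using \<open>open U\<close> by simp
  let ?w = "\<lambda>n x. \<integral>\<^sup>+t. indicator U t * (2 ^ n * indicator {t..<t + 1 / 2 ^ n} x) \<partial>lborel"
  have ev: "eventually (\<lambda>n. ?w n x = 1) sequentially" if xU: "x \<in> U" for x
  proof -
    obtain e where e: "0 < e" "ball x e \<subseteq> U" using \<open>open U\<close> xU by (meson open_contains_ball)
    show ?thesis
    proof (rule eventually_mono[OF eventually_less_inverse_power2[OF e(1)]])
      fix n :: nat assume n: "1 / 2 ^ n < e"
      have "?w n x = (\<integral>\<^sup>+t. 2 ^ n * indicator {x - 1 / 2 ^ n<..x} t \<partial>lborel)"
      proof (intro nn_integral_cong)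
        fix t :: real
        have "t \<in> U" if "t \<le> x" "x < t + 1 / 2 ^ n"
          using that n by (intro subsetD[OF e(2)]) (auto simp: dist_real_def)
        then show "indicator U t * (2 ^ n * indicator {t..<t + 1 / 2 ^ n} x :: ennreal)
            = 2 ^ n * indicator {x - 1 / 2 ^ n<..x} t"
          by (auto simp: indicator_def)
      qed
      also have "\<dots> = 2 ^ n * ennreal (1 / 2 ^ n)"
        by (subst nn_integral_cmult_indicator) auto
      also have "\<dots> = 1"
        by (rule ennreal_power2_mult_inverse)
      finally show "?w n x = 1" .
    qed
  qed
  have "emeasure M U = (\<integral>\<^sup>+x. indicator U x \<partial>M)" by simp
  also have "\<dots> \<le> (\<integral>\<^sup>+x. liminf (\<lambda>n. ?w n x) \<partial>M)"
  proof (intro nn_integral_mono)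
    fix x
    show "indicator U x \<le> liminf (\<lambda>n. ?w n x)"
    proof (cases "x \<in> U")
      case True
      then have "1 \<le> liminf (\<lambda>n. ?w n x)"
        by (intro Liminf_bounded eventually_mono[OF ev[OF True]]) simp
      then show ?thesis using True by simp
    qed simp
  qed
  also have "\<dots> \<le> liminf (\<lambda>n. \<integral>\<^sup>+x. ?w n x \<partial>M)"
    by (intro nn_integral_liminf) measurable
  also have "(\<lambda>n. \<integral>\<^sup>+x. ?w n x \<partial>M) = (\<lambda>n. \<integral>\<^sup>+t. indicator U t * dyadic_avg M n t \<partial>lborel)"
    by (subst LM.Fubini', measurable) (simp add: dyadic_avg_eq[OF assms(1)] nn_integral_cmult)
  finally show ?thesis .
qed

text \<open>An L^2 bound makes the averages uniformly integrable, so they put little mass on an open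
  set of small Lebesgue measure. Lower semicontinuity on open sets passes this to M, and a null set
  is covered by such open sets.\<close>

lemma absolutely_continuous_of_dyadic_energy:
  assumes [measurable_cong]: "sets M = sets borel" and "finite_measure M"
    and K: "\<And>n. dyadic_energy M n \<le> K" "K < top"
  shows "absolutely_continuous lborel M"
  unfolding absolutely_continuous_def
proof
  fix N :: "real set" assume N: "N \<in> null_sets lborel"
  then have [measurable]: "N \<in> sets borel" by auto
  note [measurable] = dyadic_avg_measurable[OF assms(1,2)]
  have le: "emeasure M N \<le> ennreal e * (K + 1)" if "0 < e" for e
  proof -
    \<comment> \<open>The tolerance \<open>e * e\<close> leaves a term e after multiplication by the
      factor \<open>1 / e\<close> in \<open>c\<close>.\<close>
    obtain U where U: "open U" "N \<subseteq> U" "emeasure lborel (U - N) < ennreal (e * e)"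
      using outer_regular_lborel[of N "e * e"] \<open>0 < e\<close> by auto
    then have [measurable]: "U \<in> sets borel" by simp
    have "emeasure lborel U \<le> emeasure lborel (U - N) + emeasure lborel N"
      by (rule order_trans[OF emeasure_mono emeasure_subadditive]) auto
    then have lU: "emeasure lborel U \<le> ennreal (e * e)" using U N by auto
    have c: "b \<le> ennreal e * b\<^sup>2 + ennreal (1 / e)" for b
    proof (cases "b \<le> ennreal (1 / e)")
      case True then show ?thesis by (simp add: add_increasing)
    next
      case False
      have "b = (ennreal e * ennreal (1 / e)) * b"
        using \<open>0 < e\<close> by (simp add: ennreal_mult'[symmetric])
      also have "\<dots> \<le> (ennreal e * b) * b"
        using False by (intro mult_right_mono mult_left_mono) auto
      finally show ?thesis by (simp add: add_increasing2 power2_eq_square mult.assoc)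
    qed
    have "(\<integral>\<^sup>+t. indicator U t * dyadic_avg M n t \<partial>lborel) \<le> ennreal e * (K + 1)" for n
    proof -
      have "(\<integral>\<^sup>+t. indicator U t * dyadic_avg M n t \<partial>lborel)
          \<le> (\<integral>\<^sup>+t. ennreal e * (dyadic_avg M n t)\<^sup>2 + ennreal (1 / e) * indicator U t \<partial>lborel)"
        using c by (intro nn_integral_mono) (auto simp: indicator_def)
      also have "\<dots> = ennreal e * dyadic_energy M n + ennreal (1 / e) * emeasure lborel U"
        unfolding dyadic_energy_def
        by (simp add: nn_integral_add nn_integral_cmult nn_integral_cmult_indicator)
      also have "\<dots> \<le> ennreal e * K + ennreal (1 / e) * ennreal (e * e)"
        using K lU by (intro add_mono mult_left_mono) auto
      also have "\<dots> = ennreal e * (K + 1)"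
        using \<open>0 < e\<close> by (simp add: ennreal_mult'[symmetric] distrib_left)
      finally show ?thesis .
    qed
    then have "liminf (\<lambda>n. \<integral>\<^sup>+t. indicator U t * dyadic_avg M n t \<partial>lborel) \<le> ennreal e * (K + 1)"
      by (intro Liminf_le) auto
    then show ?thesis
      using emeasure_open_le_liminf_dyadic_avg[OF assms(1,2) U(1)] emeasure_mono[OF U(2), of M]
      by (auto intro: order_trans)
  qed
  have "emeasure M N \<le> 0"
  proof (rule tendsto_lowerbound)
    \<comment> \<open>Finiteness of K matters here: multiplication by an infinite constant is not
      continuous at 0.\<close>
    have "((\<lambda>e. (K + 1) * ennreal e) \<longlongrightarrow> (K + 1) * ennreal 0) (at_right 0)"
      using K by (intro ennreal_tendsto_cmult tendsto_ennrealI tendsto_ident_at) auto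
    then show "((\<lambda>e. ennreal e * (K + 1)) \<longlongrightarrow> 0) (at_right 0)" by (simp add: mult.commute)
    show "eventually (\<lambda>e. emeasure M N \<le> ennreal e * (K + 1)) (at_right 0)"
      using le by (auto simp: eventually_at_right_less intro: eventually_mono[OF eventually_at_right_less])
  qed simp
  then show "N \<in> null_sets M" by auto
qed

text \<open>Radon-Nikodym provides a density g. By Lebesgue differentiation the averages converge to
  g almost everywhere, and Fatou bounds the integral of its square by K.\<close>

lemma measure_in_L2_of_dyadic_energy:
  assumes sets[measurable_cong]: "sets M = sets borel" and "finite_measure M"
    and K: "\<And>n. dyadic_energy M n \<le> K" "K < top"
  shows "measure_in_L2 M"
proof -
  interpret M: finite_measure M by fact
  note [measurable] = dyadic_avg_measurable[OF assms(1,2)]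
  obtain h where h[measurable]: "h \<in> borel_measurable borel" and Mh: "density lborel h = M"
    using sigma_finite_measure.Radon_Nikodym[OF sigma_finite_lborel absolutely_continuous_of_dyadic_energy[OF assms]] sets by auto
  \<comment> \<open>The density h is finite almost everywhere because M is finite;
    \<open>enn2real\<close> sends the remaining infinite values to 0.\<close>
  define g where "g = (\<lambda>t. enn2real (h t))"
  have [measurable]: "g \<in> borel_measurable borel" unfolding g_def by measurable
  have g0: "0 \<le> g t" for t by (simp add: g_def)
  have "(\<integral>\<^sup>+t. h t \<partial>lborel) = emeasure M UNIV"
    unfolding Mh[symmetric] by (subst emeasure_density) auto
  then have "(\<integral>\<^sup>+t. h t \<partial>lborel) \<noteq> \<infinity>" by simp
  then have "AE t in lborel. h t \<noteq> \<infinity>" by (intro nn_integral_PInf_AE) auto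
  then have hg: "AE t in lborel. h t = ennreal (g t)"
    by eventually_elim (simp add: g_def less_top)
  have Mg: "M = density lborel (\<lambda>t. ennreal (g t))"
    unfolding Mh[symmetric] using hg by (intro density_cong) auto
  have "(\<integral>\<^sup>+t. ennreal (g t) \<partial>lborel) = emeasure M UNIV"
    unfolding Mg by (subst emeasure_density) auto
  then have int: "integrable lborel g"
    using g0 by (intro integrableI_nonneg) (auto simp: less_top[symmetric])
  have si: "set_integrable lborel {a..b} g" for a b
    using int unfolding set_integrable_def by (intro integrable_mult_indicator) auto
  \<comment> \<open>The average is put into the shape of the differentiation theorem, with a closed
    interval; the added endpoint is Lebesgue null.\<close>
  have avg: "dyadic_avg M n t = ennreal (integral (cbox t (t + (1 / 2 ^ n) *\<^sub>R One)) g /\<^sub>R (1 / 2 ^ n) ^ DIM(real))" for n t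
  proof -
    let ?A = "{t..t + 1 / 2 ^ n}"
    have "emeasure M {t..<t + 1 / 2 ^ n} = (\<integral>\<^sup>+x. ennreal (g x) * indicator ?A x \<partial>lborel)"
      unfolding Mg
    proof (subst emeasure_density, measurable, intro nn_integral_cong_AE)
      show "AE x in lborel. ennreal (g x) * indicator {t..<t + 1 / 2 ^ n} x = ennreal (g x) * indicator ?A x"
        using AE_lborel_singleton[of "t + 1 / 2 ^ n"] by eventually_elim (auto simp: indicator_def)
    qed
    also have "\<dots> = (\<integral>\<^sup>+x. ennreal (indicator ?A x *\<^sub>R g x) \<partial>lborel)"
      by (intro nn_integral_cong) (auto simp: indicator_def)
    also have "\<dots> = ennreal (LINT x:?A|lborel. g x)"
      unfolding set_lebesgue_integral_def using si[unfolded set_integrable_def] g0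
      by (intro nn_integral_eq_integral) auto
    also have "(LINT x:?A|lborel. g x) = integral ?A g"
      by (rule set_borel_integral_eq_integral(2)[OF si])
    finally show ?thesis
      unfolding dyadic_avg_def
      by (simp add: ennreal_power2_eq ennreal_mult'[symmetric] cbox_interval power_divide)
  qed
  \<comment> \<open>Lebesgue differentiation along the one-sided intervals from x to x + h, outside
    a negligible set.\<close>
  obtain N where N: "negligible N" "\<And>x e. \<lbrakk>x \<notin> N; 0 < e\<rbrakk> \<Longrightarrow>
               \<exists>d>0. \<forall>h. 0 < h \<and> h < d \<longrightarrow>
                         norm(integral (cbox x (x + h *\<^sub>R One)) g /\<^sub>R h ^ DIM(real) - g x) < e"
    using integrable_ccontinuous_explicit[of g] set_borel_integral_eq_integral(1)[OF si]
    by (metis box_real(2))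
  have lim: "(\<lambda>n. dyadic_avg M n t) \<longlonglongrightarrow> ennreal (g t)" if tN: "t \<notin> N" for t
    unfolding avg
  proof (intro tendsto_ennrealI tendstoI)
    fix e :: real assume "0 < e"
    from N(2)[OF tN this] obtain d where d: "0 < d" "\<forall>h. 0 < h \<and> h < d \<longrightarrow>
        norm(integral (cbox t (t + h *\<^sub>R One)) g /\<^sub>R h ^ DIM(real) - g t) < e"
      by (elim exE conjE)
    show "\<forall>\<^sub>F n in sequentially. dist (integral (cbox t (t + (1 / 2 ^ n) *\<^sub>R One)) g /\<^sub>R (1 / 2 ^ n) ^ DIM(real)) (g t) < e"
      by (rule eventually_mono[OF eventually_less_inverse_power2[OF d(1)]])
        (unfold dist_norm, rule d(2)[rule_format], auto)
  qed
  have "AE t in lebesgue. t \<notin> N"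
    using N(1) by (simp add: AE_not_in negligible_iff_null_sets)
  then have AEN: "AE t in lborel. t \<notin> N" by (simp add: AE_completion_iff)
  have "(\<integral>\<^sup>+t. ennreal ((g t)\<^sup>2) \<partial>lborel) \<le> (\<integral>\<^sup>+t. liminf (\<lambda>n. (dyadic_avg M n t)\<^sup>2) \<partial>lborel)"
  proof (rule nn_integral_mono_AE)
    show "AE t in lborel. ennreal ((g t)\<^sup>2) \<le> liminf (\<lambda>n. (dyadic_avg M n t)\<^sup>2)"
      using AEN
    proof eventually_elim
      fix t assume "t \<notin> N"
      have "(\<lambda>n. (dyadic_avg M n t)\<^sup>2) \<longlonglongrightarrow> (ennreal (g t))\<^sup>2"
        unfolding power2_eq_square by (intro tendsto_mult_ennreal lim \<open>t \<notin> N\<close>) auto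
      then have "liminf (\<lambda>n. (dyadic_avg M n t)\<^sup>2) = (ennreal (g t))\<^sup>2"
        by (intro lim_imp_Liminf) auto
      then show "ennreal ((g t)\<^sup>2) \<le> liminf (\<lambda>n. (dyadic_avg M n t)\<^sup>2)"
        using g0 by (simp add: ennreal_power)
    qed
  qed
  also have "\<dots> \<le> liminf (dyadic_energy M)"
    unfolding dyadic_energy_def[abs_def] by (intro nn_integral_liminf) measurable
  also have "\<dots> \<le> K" using K(1) by (intro Liminf_le) auto
  finally have "(\<integral>\<^sup>+t. ennreal ((g t)\<^sup>2) \<partial>lborel) < \<infinity>" using K(2) by (simp add: le_less_trans)
  then have "integrable lborel (\<lambda>t. (g t)\<^sup>2)" by (intro integrableI_nonneg) auto
  with Mg g0 show ?thesis unfolding measure_in_L2_def by (intro exI[of _ g]) auto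
qed

text \<open>Replaces the existence of a density by finiteness of a countable supremum, whose
  dependence on a direction can be seen to be Borel.\<close>

lemma measure_in_L2_iff:
  assumes "sets M = sets borel" "finite_measure M"
  shows "measure_in_L2 M \<longleftrightarrow> (SUP n. dyadic_energy M n) < top"
proof
  assume "measure_in_L2 M"
  then obtain f where f: "f \<in> borel_measurable borel" "\<And>t. 0 \<le> f t" "M = density lborel (\<lambda>t. ennreal (f t))"
    "integrable lborel (\<lambda>t. (f t)\<^sup>2)"
    unfolding measure_in_L2_def by auto
  have "(SUP n. dyadic_energy M n) \<le> (\<integral>\<^sup>+t. ennreal ((f t)\<^sup>2) \<partial>lborel)"
    using dyadic_energy_le_of_density[OF f(1-3)] by (intro SUP_least)
  also have "\<dots> < top" using f(4) by (simp add: nn_integral_eq_integral)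
  finally show "(SUP n. dyadic_energy M n) < top" .
next
  assume "(SUP n. dyadic_energy M n) < top"
  then show "measure_in_L2 M"
    using assms by (intro measure_in_L2_of_dyadic_energy[where K="SUP n. dyadic_energy M n"]) (auto intro: SUP_upper)
qed

text \<open>The image has density \<open>f (t / c) / \<bar>c\<bar>\<close>. This makes square
  integrability of a projection insensitive to the length of the direction vector.\<close>

lemma measure_in_L2_scale:
  assumes "measure_in_L2 M" "c \<noteq> 0"
  shows "measure_in_L2 (distr M borel (\<lambda>t. c * t))"
proof -
  obtain f where f[measurable]: "f \<in> borel_measurable borel" and f0: "\<And>t. 0 \<le> f t"
    and M: "M = density lborel (\<lambda>t. ennreal (f t))" and int: "integrable lborel (\<lambda>t. (f t)\<^sup>2)"
    using assms(1) unfolding measure_in_L2_def by auto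
  let ?g = "\<lambda>t. f (t / c) / \<bar>c\<bar>"
  have "distr M borel (\<lambda>t. c * t) = density lborel (\<lambda>t. ennreal (?g t))"
  proof (rule measure_eqI)
    fix A :: "real set" assume "A \<in> sets (distr M borel (\<lambda>t. c * t))"
    then have [measurable]: "A \<in> sets borel" by simp
    have "emeasure (density lborel (\<lambda>t. ennreal (?g t))) A
        = (\<integral>\<^sup>+t. ennreal (?g t) * indicator A t \<partial>lborel)"
      by (subst emeasure_density) auto
    also have "\<dots> = ennreal \<bar>c\<bar> * (\<integral>\<^sup>+t. ennreal (?g (0 + c * t)) * indicator A (0 + c * t) \<partial>lborel)"
      using assms(2) by (intro nn_integral_real_affine) auto
    also have "\<dots> = (\<integral>\<^sup>+t. ennreal (f t) * indicator ((\<lambda>t. c * t) -` A) t \<partial>lborel)"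
      using assms(2) f0
      by (subst nn_integral_cmult[symmetric], measurable)
         (auto intro!: nn_integral_cong simp: indicator_def ennreal_mult'[symmetric])
    also have "\<dots> = emeasure (distr M borel (\<lambda>t. c * t)) A"
      unfolding M by (subst emeasure_distr, simp, simp) (subst emeasure_density, auto intro!: measurable_sets_borel[of _ borel])
    finally show "emeasure (distr M borel (\<lambda>t. c * t)) A = emeasure (density lborel (\<lambda>t. ennreal (?g t))) A" ..
  qed simp
  moreover have "integrable lborel (\<lambda>t. (?g t)\<^sup>2)"
  proof -
    have "integrable lborel (\<lambda>t. (f (0 + (1 / c) * t))\<^sup>2)"
      using assms(2) int by (intro lborel_integrable_real_affine[where f="\<lambda>t. (f t)\<^sup>2"]) auto
    then show ?thesis by (simp add: power_divide)
  qed
  ultimately show ?thesis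
    unfolding measure_in_L2_def using f0 by (intro exI[of _ ?g]) auto
qed

section \<open>Projections in almost every direction\<close>

lemma tent_le: "tent n u \<le> 2 ^ n * indicator {u. \<bar>u\<bar> < 1 / 2 ^ n} u"
proof (cases "\<bar>u\<bar> < 1 / 2 ^ n")
  case True
  have "4 ^ n * max 0 (1 / 2 ^ n - \<bar>u\<bar>) \<le> 4 ^ n * (1 / 2 ^ n)"
    by (intro mult_left_mono) auto
  also have "\<dots> = 2 ^ n" by (simp add: field_simps flip: power_mult_distrib)
  finally show ?thesis using True by (simp add: tent_def ennreal_power2_eq ennreal_leI)
qed (simp add: tent_def max_def)

text \<open>The tent has peak \<open>2 ^ n\<close> and decreases linearly, so it keeps half of that
  height on the inner half of its support.\<close>

lemma tent_ge: "ennreal (2 ^ n / 2) * indicator {u. \<bar>u\<bar> < 1 / 2 ^ Suc n} u \<le> tent n u"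
proof (cases "\<bar>u\<bar> < 1 / 2 ^ Suc n")
  case True
  have "2 ^ n / 2 = 4 ^ n * (1 / 2 ^ n - 1 / 2 ^ Suc n :: real)"
    by (simp add: field_simps flip: power_mult_distrib)
  also have "\<dots> \<le> 4 ^ n * max 0 (1 / 2 ^ n - \<bar>u\<bar>)"
    using True by (intro mult_left_mono) auto
  finally show ?thesis using True by (simp add: tent_def ennreal_leI del: power_Suc)
qed simp

text \<open>The tent vanishes unless \<open>c < 1 / 2 ^ n\<close>, and then its peak
  \<open>2 ^ n\<close> is below \<open>1 / c\<close>. The bound is the same at all scales.\<close>

lemma tent_le_inverse:
  assumes "0 < c" "c \<le> \<bar>u\<bar>" shows "tent n u \<le> ennreal (1 / c)"
proof (cases "\<bar>u\<bar> < 1 / 2 ^ n")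
  case True
  then have "c < 1 / 2 ^ n" using assms by simp
  then have "2 ^ n \<le> 1 / c" using assms by (simp add: field_simps)
  then show ?thesis
    using order_trans[OF tent_le[of n u]] True by (simp add: ennreal_power2_eq ennreal_leI)
qed (simp add: tent_def max_def)

lemma abs_affine_less_iff:
  fixes p :: real assumes "p \<noteq> 0"
  shows "\<bar>s * p + q\<bar> < r \<longleftrightarrow> s \<in> ball (- q / p) (r / \<bar>p\<bar>)"
proof -
  have "s * p + q = - (p * (- q / p - s))"
    using assms by (simp add: field_simps)
  then have "\<bar>s * p + q\<bar> = \<bar>p\<bar> * dist (- q / p) s"
    by (simp add: abs_mult dist_real_def)
  then show ?thesis using assms by (simp add: pos_less_divide_eq mult.commute)
qed

text \<open>Either the affine function is steep, and a change of variables bounds the integral by a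
  multiple of \<open>1 / \<bar>p\<bar>\<close>, or it stays away from 0 on the interval, and the
  tent itself is bounded by a multiple of \<open>1 / \<bar>q\<bar>\<close>.\<close>

lemma nn_integral_tent_affine_le:
  assumes r: "0 \<le> r" "r \<le> \<bar>p\<bar> + \<bar>q\<bar>"
  shows "(\<integral>\<^sup>+s. indicator {-2<..<2} s * tent n (s * p + q) \<partial>lborel) \<le> 10 * inverse (ennreal r)"
proof (cases "r = 0")
  case True
  \<comment> \<open>The right side is infinite, since \<open>inverse 0 = top\<close>.\<close>
  then show ?thesis by simp
next
  case False
  then have r0: "0 < r" using r by simp
  have rhs: "10 * inverse (ennreal r) = ennreal (10 / r)"
    using r0 by (simp add: inverse_ennreal divide_inverse ennreal_mult)
  \<comment> \<open>With threshold 4, the steep case has \<open>r \<le> 5 * \<bar>p\<bar>\<close>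
    and bound \<open>2 / \<bar>p\<bar>\<close>. The other has
    \<open>r \<le> 5 / 4 * \<bar>q\<bar>\<close> and bound \<open>8 / \<bar>q\<bar>\<close>, the
    interval having length 4. Both give \<open>10 / r\<close>.\<close>
  show ?thesis
  proof (cases "\<bar>q\<bar> \<le> 4 * \<bar>p\<bar>")
    case True
    then have p: "p \<noteq> 0" using r r0 by auto
    have "(\<integral>\<^sup>+s. indicator {-2<..<2} s * tent n (s * p + q) \<partial>lborel)
        \<le> (\<integral>\<^sup>+s. 2 ^ n * indicator (ball (- q / p) (1 / 2 ^ n / \<bar>p\<bar>)) s \<partial>lborel)"
    proof (intro nn_integral_mono)
      fix s
      have "indicator {-2<..<2} s * tent n (s * p + q) \<le> tent n (s * p + q)"
        by (auto simp: indicator_def)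
      also have "\<dots> \<le> 2 ^ n * indicator (ball (- q / p) (1 / 2 ^ n / \<bar>p\<bar>)) s"
        using tent_le[of n "s * p + q"]
        unfolding indicator_def mem_Collect_eq abs_affine_less_iff[OF p] .
      finally show "indicator {-2<..<2} s * tent n (s * p + q)
          \<le> 2 ^ n * indicator (ball (- q / p) (1 / 2 ^ n / \<bar>p\<bar>)) s" .
    qed
    also have "\<dots> = 2 ^ n * emeasure lborel (ball (- q / p) (1 / 2 ^ n / \<bar>p\<bar>))"
      by (subst nn_integral_cmult_indicator) auto
    also have "\<dots> = ennreal (2 / \<bar>p\<bar>)"
      using p by (simp add: ball_eq_greaterThanLessThan ennreal_power2_eq ennreal_mult'[symmetric])
    also have "\<dots> \<le> ennreal (10 / r)"
      using True r r0 p by (intro ennreal_leI) (simp add: field_simps)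
    finally show ?thesis unfolding rhs .
  next
    case False
    then have q: "\<bar>q\<bar> > 0" by auto
    have "(\<integral>\<^sup>+s. indicator {-2<..<2} s * tent n (s * p + q) \<partial>lborel)
        \<le> (\<integral>\<^sup>+s. ennreal (1 / (\<bar>q\<bar> / 2)) * indicator {-2<..<2::real} s \<partial>lborel)"
    proof (intro nn_integral_mono)
      fix s :: real
      have "tent n (s * p + q) \<le> ennreal (1 / (\<bar>q\<bar> / 2))" if "s \<in> {-2<..<2}"
      proof (rule tent_le_inverse)
        have "\<bar>s * p\<bar> \<le> 2 * \<bar>p\<bar>" unfolding abs_mult using that by (intro mult_right_mono) auto
        then show "\<bar>q\<bar> / 2 \<le> \<bar>s * p + q\<bar>" using False by linarith
      qed (use q in simp)
      then show "indicator {-2<..<2} s * tent n (s * p + q) \<le> ennreal (1 / (\<bar>q\<bar> / 2)) * indicator {-2<..<2} s"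
        by (auto simp: indicator_def)
    qed
    also have "\<dots> = ennreal (1 / (\<bar>q\<bar> / 2)) * ennreal 4"
      by (subst nn_integral_cmult_indicator) auto
    also have "\<dots> = ennreal (8 / \<bar>q\<bar>)"
      by (subst ennreal_mult'[symmetric]) auto
    also have "\<dots> \<le> ennreal (10 / r)"
      using False r r0 q by (intro ennreal_leI) (simp add: field_simps)
    finally show ?thesis unfolding rhs .
  qed
qed

text \<open>The tent approximates a unit point mass at 0, so its pullback concentrates mass
  \<open>1 / \<bar>p\<bar>\<close> at the root \<open>- q / p\<close>. The inner half of its
  support, eventually inside U, already accounts for half of that.\<close>

lemma eventually_nn_integral_tent_affine_ge:
  assumes "open U" "p \<noteq> 0" "- q / p \<in> U"
  shows "eventually (\<lambda>n. ennreal (1 / (2 * \<bar>p\<bar>)) \<le> (\<integral>\<^sup>+s. indicator U s * tent n (s * p + q) \<partial>lborel)) sequentially"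
proof -
  have [measurable]: "U \<in> sets borel" using \<open>open U\<close> by simp
  obtain e where e: "0 < e" "ball (- q / p) e \<subseteq> U" using assms by (meson open_contains_ball)
  have "0 < e * \<bar>p\<bar>" using e(1) assms(2) by simp
  then show ?thesis
  proof (rule eventually_mono[OF eventually_less_inverse_power2])
    fix n :: nat assume n: "1 / 2 ^ n < e * \<bar>p\<bar>"
    let ?B = "ball (- q / p) (1 / 2 ^ Suc n / \<bar>p\<bar>)"
    have "1 / 2 ^ Suc n \<le> 1 / (2::real) ^ n" by (simp add: field_simps)
    then have "1 / 2 ^ Suc n < e * \<bar>p\<bar>" using n by simp
    then have "1 / 2 ^ Suc n / \<bar>p\<bar> < e" using assms(2) by (simp add: divide_less_eq mult_ac del: power_Suc)
    then have "?B \<subseteq> ball (- q / p) e" by (intro subset_ball) simp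
    then have BU: "?B \<subseteq> U" using e(2) by blast
    have "ennreal (1 / (2 * \<bar>p\<bar>)) = ennreal (2 ^ n / 2) * ennreal (2 * (1 / 2 ^ Suc n / \<bar>p\<bar>))"
      using assms(2) by (subst ennreal_mult[symmetric]) (auto simp: field_simps)
    also have "\<dots> = ennreal (2 ^ n / 2) * emeasure lborel ?B"
      by (simp add: ball_eq_greaterThanLessThan mult_ac)
    also have "\<dots> = (\<integral>\<^sup>+s. ennreal (2 ^ n / 2) * indicator ?B s \<partial>lborel)"
      by (subst nn_integral_cmult_indicator) auto
    also have "\<dots> \<le> (\<integral>\<^sup>+s. indicator U s * tent n (s * p + q) \<partial>lborel)"
    proof (intro nn_integral_mono)
      fix s
      show "ennreal (2 ^ n / 2) * indicator ?B s \<le> indicator U s * tent n (s * p + q)"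
      proof (cases "s \<in> ?B")
        case True
        then have "\<bar>s * p + q\<bar> < 1 / 2 ^ Suc n" unfolding abs_affine_less_iff[OF assms(2)] .
        then show ?thesis using True BU tent_ge[of n "s * p + q"] by (simp add: indicator_def subset_iff)
      qed simp
    qed
    finally show "ennreal (1 / (2 * \<bar>p\<bar>)) \<le> (\<integral>\<^sup>+s. indicator U s * tent n (s * p + q) \<partial>lborel)" .
  qed
qed

section \<open>Energies of projections, averaged over directions\<close>

definition proj_measure :: "'a::euclidean_space measure \<Rightarrow> 'a \<Rightarrow> real measure" where
  "proj_measure M v = distr M borel (\<lambda>y. y \<bullet> v)"

definition proj_energy :: "'a::euclidean_space measure \<Rightarrow> 'a \<Rightarrow> ennreal" where
  "proj_energy M v = (SUP n. dyadic_energy (proj_measure M v) n)"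

text \<open>As \<open>inverse 0 = top\<close>, finiteness of this energy excludes atoms.\<close>

definition riesz_energy :: "'a::euclidean_space measure \<Rightarrow> ennreal" where
  "riesz_energy M = (\<integral>\<^sup>+x. \<integral>\<^sup>+y. inverse (ennreal (norm (x - y))) \<partial>M \<partial>M)"

lemma sets_proj_measure [simp]: "sets (proj_measure M v) = sets borel"
  by (simp add: proj_measure_def)

lemma finite_proj_measure:
  assumes [measurable_cong]: "sets M = sets borel" and "finite_measure M"
  shows "finite_measure (proj_measure M v)"
  unfolding proj_measure_def by (rule finite_measure.finite_measure_distr[OF assms(2)]) measurable

lemma nn_integral_dyadic_avg_proj_mult:
  assumes [measurable_cong]: "sets M = sets borel" "sets N = sets borel"
    and fin: "finite_measure M" "finite_measure N"
  shows "(\<integral>\<^sup>+t. dyadic_avg (proj_measure M v) n t * dyadic_avg (proj_measure N v) n t \<partial>lborel)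
    = (\<integral>\<^sup>+x. \<integral>\<^sup>+y. tent n ((x - y) \<bullet> v) \<partial>N \<partial>M)"
proof -
  interpret N: finite_measure N by fact
  interpret Nv: finite_measure "proj_measure N v" by (rule finite_proj_measure; fact)
  have [measurable_cong]: "sets (proj_measure N v) = sets borel" by simp
  have "(\<integral>\<^sup>+t. dyadic_avg (proj_measure M v) n t * dyadic_avg (proj_measure N v) n t \<partial>lborel)
      = (\<integral>\<^sup>+x. \<integral>\<^sup>+y. tent n (x - y) \<partial>proj_measure N v \<partial>proj_measure M v)"
    by (rule nn_integral_dyadic_avg_mult) (auto intro!: finite_proj_measure assms)
  also have "\<dots> = (\<integral>\<^sup>+x. \<integral>\<^sup>+y. tent n (x - y) \<partial>proj_measure N v \<partial>distr M borel (\<lambda>y. y \<bullet> v))"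
    by (simp add: proj_measure_def)
  also have "\<dots> = (\<integral>\<^sup>+x. \<integral>\<^sup>+y. tent n (x \<bullet> v - y) \<partial>proj_measure N v \<partial>M)"
    by (rule nn_integral_distr) measurable
  also have "\<dots> = (\<integral>\<^sup>+x. \<integral>\<^sup>+y. tent n ((x - y) \<bullet> v) \<partial>N \<partial>M)"
    unfolding proj_measure_def by (subst nn_integral_distr) (auto simp: inner_diff_left)
  finally show ?thesis .
qed

lemma dyadic_energy_proj_eq:
  assumes "sets M = sets borel" "finite_measure M"
  shows "dyadic_energy (proj_measure M v) n = (\<integral>\<^sup>+x. \<integral>\<^sup>+y. tent n ((x - y) \<bullet> v) \<partial>M \<partial>M)"
  using nn_integral_dyadic_avg_proj_mult[OF assms(1) assms(1) assms(2) assms(2)]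
  by (simp add: dyadic_energy_def power2_eq_square)

text \<open>In the tent formula v enters only through a jointly Borel integrand, so Tonelli yields
  measurability.\<close>

lemma measurable_dyadic_energy_proj:
  assumes [measurable_cong]: "sets M = sets borel" and "finite_measure M"
  shows "(\<lambda>v. dyadic_energy (proj_measure M v) n) \<in> borel_measurable borel"
proof -
  interpret finite_measure M by fact
  show ?thesis unfolding dyadic_energy_proj_eq[OF assms] by measurable
qed

lemma measurable_proj_energy:
  assumes "sets M = sets borel" "finite_measure M"
  shows "proj_energy M \<in> borel_measurable borel"
proof -
  note [measurable] = measurable_dyadic_energy_proj[OF assms]
  show ?thesis unfolding proj_energy_def[abs_def] by measurable
qed

text \<open>
  The directions \<open>s *\<^sub>R a + b\<close> with \<open>\<bar>s\<bar> \<le> 1\<close>, for \<open>a, b\<close> the two coordinate vectors in either order, cover all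
  lines through the origin. The parameter interval is taken larger, so that the relevant slopes are
  interior points.
\<close>
lemma nn_integral_proj_energy_le:
  fixes a b :: "'a::euclidean_space"
  assumes [measurable_cong]: "sets M = sets borel" and "finite_measure M"
    and ab: "\<And>z. norm z \<le> \<bar>z \<bullet> a\<bar> + \<bar>z \<bullet> b\<bar>"
  shows "(\<integral>\<^sup>+s. indicator {-2<..<2} s * proj_energy M (s *\<^sub>R a + b) \<partial>lborel) \<le> 10 * riesz_energy M"
proof -
  interpret finite_measure M by fact
  interpret LM: pair_sigma_finite lborel M by unfold_locales
  let ?V = "{-2<..<2::real}"
  let ?e = "\<lambda>n s. dyadic_energy (proj_measure M (s *\<^sub>R a + b)) n"
  note measurable_dyadic_energy_proj[OF assms(1,2), measurable]
  have "(\<integral>\<^sup>+s. indicator ?V s * proj_energy M (s *\<^sub>R a + b) \<partial>lborel)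
      = (\<integral>\<^sup>+s. (SUP n. indicator ?V s * ?e n s) \<partial>lborel)"
    by (simp add: proj_energy_def SUP_mult_left_ennreal)
  also have "\<dots> = (SUP n. \<integral>\<^sup>+s. indicator ?V s * ?e n s \<partial>lborel)"
  proof (rule nn_integral_monotone_convergence_SUP)
    show "incseq (\<lambda>n s. indicator ?V s * ?e n s)"
      using incseq_dyadic_energy[OF sets_proj_measure finite_proj_measure[OF assms(1,2)]]
      by (auto simp: incseq_def le_fun_def intro!: mult_left_mono)
  qed measurable
  also have "\<dots> \<le> 10 * riesz_energy M"
  proof (rule SUP_least)
    fix n
    have "(\<integral>\<^sup>+s. indicator ?V s * ?e n s \<partial>lborel)
        = (\<integral>\<^sup>+s. \<integral>\<^sup>+x. \<integral>\<^sup>+y. indicator ?V s * tent n ((x - y) \<bullet> (s *\<^sub>R a + b)) \<partial>M \<partial>M \<partial>lborel)"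
      unfolding dyadic_energy_proj_eq[OF assms(1,2)] by (simp add: nn_integral_cmult)
    also have "\<dots> = (\<integral>\<^sup>+x. \<integral>\<^sup>+s. \<integral>\<^sup>+y. indicator ?V s * tent n ((x - y) \<bullet> (s *\<^sub>R a + b)) \<partial>M \<partial>lborel \<partial>M)"
      by (subst LM.Fubini') measurable
    also have "\<dots> = (\<integral>\<^sup>+x. \<integral>\<^sup>+y. \<integral>\<^sup>+s. indicator ?V s * tent n ((x - y) \<bullet> (s *\<^sub>R a + b)) \<partial>lborel \<partial>M \<partial>M)"
      by (intro nn_integral_cong LM.Fubini'[symmetric]) measurable
    \<comment> \<open>The affine estimate applies with \<open>p = (x - y) \<bullet> a\<close>,
      \<open>q = (x - y) \<bullet> b\<close> and r the norm of \<open>x - y\<close>; its hypothesis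
      on r is \<open>ab\<close>.\<close>
    also have "\<dots> \<le> (\<integral>\<^sup>+x. \<integral>\<^sup>+y. 10 * inverse (ennreal (norm (x - y))) \<partial>M \<partial>M)"
      unfolding inner_add_right inner_scaleR_right
      by (intro nn_integral_mono nn_integral_tent_affine_le ab) auto
    also have "\<dots> = 10 * riesz_energy M"
      unfolding riesz_energy_def by (simp add: nn_integral_cmult)
    finally show "(\<integral>\<^sup>+s. indicator ?V s * ?e n s \<partial>lborel) \<le> 10 * riesz_energy M" .
  qed
  finally show ?thesis .
qed

text \<open>The left side is the inner product of the two mollified projections, whence a bound free
  of n.\<close>

lemma nn_integral_tent_le_proj_energy:
  assumes [measurable_cong]: "sets M = sets borel" "sets N = sets borel"
    and fin: "finite_measure M" "finite_measure N"
  shows "(\<integral>\<^sup>+x. \<integral>\<^sup>+y. tent n ((x - y) \<bullet> v) \<partial>N \<partial>M) \<le> proj_energy M v + proj_energy N v"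
proof -
  note [measurable] = dyadic_avg_measurable[OF sets_proj_measure finite_proj_measure, OF assms(1) fin(1)]
    dyadic_avg_measurable[OF sets_proj_measure finite_proj_measure, OF assms(2) fin(2)]
  have "(\<integral>\<^sup>+x. \<integral>\<^sup>+y. tent n ((x - y) \<bullet> v) \<partial>N \<partial>M)
      \<le> (\<integral>\<^sup>+t. (dyadic_avg (proj_measure M v) n t)\<^sup>2 + (dyadic_avg (proj_measure N v) n t)\<^sup>2 \<partial>lborel)"
    unfolding nn_integral_dyadic_avg_proj_mult[OF assms, symmetric]
    by (intro nn_integral_mono ennreal_mult_le_sum_squares)
  also have "\<dots> = dyadic_energy (proj_measure M v) n + dyadic_energy (proj_measure N v) n"
    unfolding dyadic_energy_def by (rule nn_integral_add) measurable
  also have "\<dots> \<le> proj_energy M v + proj_energy N v"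
    unfolding proj_energy_def by (intro add_mono SUP_upper) auto
  finally show ?thesis .
qed

text \<open>The slope in question is the s for which \<open>s *\<^sub>R a + b\<close> is orthogonal
  to \<open>x - y\<close>. The law of the slope, weighted by a positive function, is dominated by
  the finite measure m with Lebesgue density G; hence it does not charge the Lebesgue null set Z of
  slopes where the energy of P is infinite.\<close>

lemma AE_proj_energy_slope_finite:
  fixes a b :: "'a::euclidean_space"
  assumes [measurable_cong]: "sets M = sets borel" "sets N = sets borel"
    and fin: "finite_measure M" "finite_measure N"
    and P: "sets P = sets borel" "finite_measure P"
    and ab: "\<And>z. norm z \<le> \<bar>z \<bullet> a\<bar> + \<bar>z \<bullet> b\<bar>"
    and riesz: "riesz_energy M < top" "riesz_energy N < top" "riesz_energy P < top"
  shows "AE (x, y) in M \<Otimes>\<^sub>M N. (x - y) \<bullet> a \<noteq> 0 \<longrightarrow> - ((x - y) \<bullet> b) / ((x - y) \<bullet> a) \<in> {-2<..<2} \<longrightarrow>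
    proj_energy P ((- ((x - y) \<bullet> b) / ((x - y) \<bullet> a)) *\<^sub>R a + b) < top"
proof -
  interpret M: finite_measure M by fact
  interpret N: finite_measure N by fact
  interpret MN: pair_sigma_finite M N by unfold_locales
  interpret L: pair_sigma_finite lborel "M \<Otimes>\<^sub>M N" by unfold_locales
  note [measurable] = measurable_proj_energy[OF assms(1) fin(1)] measurable_proj_energy[OF assms(2) fin(2)]
    measurable_proj_energy[OF P]
  let ?V = "{-2<..<2::real}"
  define p where "p = (\<lambda>w::'a \<times> 'a. (fst w - snd w) \<bullet> a)"
  define q where "q = (\<lambda>w::'a \<times> 'a. (fst w - snd w) \<bullet> b)"
  have [measurable]: "p \<in> borel_measurable (M \<Otimes>\<^sub>M N)" "q \<in> borel_measurable (M \<Otimes>\<^sub>M N)"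
    unfolding p_def q_def by measurable
  let ?E = "\<lambda>Q s. proj_energy Q (s *\<^sub>R a + b)"
  define Z where "Z = {s \<in> ?V. ?E P s = top}"
  have [measurable]: "Z \<in> sets borel" unfolding Z_def by measurable
  have "(\<integral>\<^sup>+s. indicator ?V s * ?E P s \<partial>lborel) < top"
    using nn_integral_proj_energy_le[OF P ab] riesz(3) by (auto simp: ennreal_mult_less_top intro: le_less_trans)
  then have "AE s in lborel. indicator ?V s * ?E P s \<noteq> \<infinity>"
    by (intro nn_integral_PInf_AE) auto
  then have AEZ: "AE s in lborel. s \<notin> Z"
    by eventually_elim (auto simp: Z_def)
  define G where "G = (\<lambda>s. indicator ?V s * ?E M s + indicator ?V s * ?E N s)"
  have [measurable]: "G \<in> borel_measurable borel" unfolding G_def by measurable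
  define m where "m = density lborel G"
  have "emeasure m UNIV = (\<integral>\<^sup>+s. indicator ?V s * ?E M s \<partial>lborel) + (\<integral>\<^sup>+s. indicator ?V s * ?E N s \<partial>lborel)"
    unfolding m_def G_def by (subst emeasure_density) (auto simp: nn_integral_add)
  also have "\<dots> \<le> 10 * riesz_energy M + 10 * riesz_energy N"
    by (intro add_mono nn_integral_proj_energy_le assms)
  also have "\<dots> < top" using riesz by (simp add: ennreal_mult_less_top)
  finally have m_fin: "emeasure m (space m) \<noteq> \<infinity>" by (simp add: m_def)
  have "emeasure m Z = (\<integral>\<^sup>+s. G s * indicator Z s \<partial>lborel)"
    unfolding m_def by (rule emeasure_density) auto
  also have "\<dots> = (\<integral>\<^sup>+s. 0 \<partial>(lborel :: real measure))"
    by (rule nn_integral_cong_AE, rule eventually_mono[OF AEZ]) simp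
  finally have mZ: "emeasure m Z = 0" by simp
  let ?bad = "\<lambda>w. p w \<noteq> 0 \<and> - q w / p w \<in> Z"
  \<comment> \<open>The weight is the lower bound that the tent integrals reach in the limit. It is
    positive, so a vanishing integral of \<phi> means that almost no pair is bad.\<close>
  define \<phi> where "\<phi> = (\<lambda>w. if ?bad w then ennreal (1 / (2 * \<bar>p w\<bar>)) else 0)"
  have [measurable]: "\<phi> \<in> borel_measurable (M \<Otimes>\<^sub>M N)" unfolding \<phi>_def by measurable
  have small: "(\<integral>\<^sup>+w. \<phi> w \<partial>(M \<Otimes>\<^sub>M N)) \<le> emeasure m U" if U: "open U" "Z \<subseteq> U" for U
  proof -
    \<comment> \<open>Intersecting with \<open>?V\<close> loses no bad slope, as Z lies in
      \<open>?V\<close>, and makes G the dominating function.\<close>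
    let ?W = "U \<inter> ?V"
    have W: "open ?W" using U by auto
    then have [measurable]: "?W \<in> sets borel" "U \<in> sets borel" using U by auto
    let ?T = "\<lambda>n w. \<integral>\<^sup>+s. indicator ?W s * tent n (s * p w + q w) \<partial>lborel"
    have "(\<integral>\<^sup>+w. \<phi> w \<partial>(M \<Otimes>\<^sub>M N)) \<le> (\<integral>\<^sup>+w. liminf (\<lambda>n. ?T n w) \<partial>(M \<Otimes>\<^sub>M N))"
    proof (intro nn_integral_mono)
      fix w
      show "\<phi> w \<le> liminf (\<lambda>n. ?T n w)"
      proof (cases "?bad w")
        case True
        then have "- q w / p w \<in> ?W" using U(2) by (auto simp: Z_def)
        then have "ennreal (1 / (2 * \<bar>p w\<bar>)) \<le> liminf (\<lambda>n. ?T n w)"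
          using True W by (intro Liminf_bounded eventually_nn_integral_tent_affine_ge) auto
        then show ?thesis using True by (simp add: \<phi>_def)
      qed (auto simp: \<phi>_def)
    qed
    \<comment> \<open>Fatou moves the limit outside; at each fixed scale Tonelli and the bound by
      projection energies then apply.\<close>
    also have "\<dots> \<le> liminf (\<lambda>n. \<integral>\<^sup>+w. ?T n w \<partial>(M \<Otimes>\<^sub>M N))"
      by (intro nn_integral_liminf) measurable
    also have "\<dots> \<le> emeasure m U"
    proof (intro Liminf_le always_eventually allI)
      fix n
      have "(\<integral>\<^sup>+w. ?T n w \<partial>(M \<Otimes>\<^sub>M N))
          = (\<integral>\<^sup>+s. \<integral>\<^sup>+w. indicator ?W s * tent n (s * p w + q w) \<partial>(M \<Otimes>\<^sub>M N) \<partial>lborel)"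
        by (subst L.Fubini') measurable
      also have "\<dots> = (\<integral>\<^sup>+s. indicator ?W s * (\<integral>\<^sup>+x. \<integral>\<^sup>+y. tent n ((x - y) \<bullet> (s *\<^sub>R a + b)) \<partial>N \<partial>M) \<partial>lborel)"
      proof (intro nn_integral_cong)
        fix s
        have "(\<integral>\<^sup>+w. tent n (s * p w + q w) \<partial>(M \<Otimes>\<^sub>M N)) = (\<integral>\<^sup>+x. \<integral>\<^sup>+y. tent n (s * p (x, y) + q (x, y)) \<partial>N \<partial>M)"
          by (rule N.nn_integral_fst[symmetric]) measurable
        then show "(\<integral>\<^sup>+w. indicator ?W s * tent n (s * p w + q w) \<partial>(M \<Otimes>\<^sub>M N))
          = indicator ?W s * (\<integral>\<^sup>+x. \<integral>\<^sup>+y. tent n ((x - y) \<bullet> (s *\<^sub>R a + b)) \<partial>N \<partial>M)"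
          by (subst nn_integral_cmult, measurable) (simp add: p_def q_def inner_add_right)
      qed
      also have "\<dots> \<le> (\<integral>\<^sup>+s. indicator ?W s * (?E M s + ?E N s) \<partial>lborel)"
        by (intro nn_integral_mono mult_left_mono nn_integral_tent_le_proj_energy assms) auto
      also have "\<dots> = (\<integral>\<^sup>+s. G s * indicator U s \<partial>lborel)"
        by (intro nn_integral_cong) (auto simp: G_def indicator_def)
      also have "\<dots> = emeasure m U"
        unfolding m_def by (subst emeasure_density) auto
      finally show "(\<integral>\<^sup>+w. ?T n w \<partial>(M \<Otimes>\<^sub>M N)) \<le> emeasure m U" .
    qed simp
    finally show ?thesis .
  qed
  \<comment> \<open>The estimate is available for open sets only; outer regularity of the finite
    measure m carries it to Z.\<close>
  have "(\<integral>\<^sup>+w. \<phi> w \<partial>(M \<Otimes>\<^sub>M N)) \<le> (INF U\<in>{U. Z \<subseteq> U \<and> open U}. emeasure m U)"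
    using small by (intro INF_greatest) auto
  also have "\<dots> = emeasure m Z"
    by (rule outer_regular[symmetric]) (use m_fin in \<open>auto simp: m_def\<close>)
  finally have "(\<integral>\<^sup>+w. \<phi> w \<partial>(M \<Otimes>\<^sub>M N)) = 0" using mZ by simp
  then have "AE w in M \<Otimes>\<^sub>M N. \<phi> w = 0" by (subst (asm) nn_integral_0_iff_AE) auto
  then show ?thesis
  proof eventually_elim
    fix w assume "\<phi> w = 0"
    then have "\<not> ?bad w" by (auto simp: \<phi>_def split: if_splits)
    then show "case w of (x, y) \<Rightarrow> (x - y) \<bullet> a \<noteq> 0 \<longrightarrow> - ((x - y) \<bullet> b) / ((x - y) \<bullet> a) \<in> {-2<..<2} \<longrightarrow>
      proj_energy P ((- ((x - y) \<bullet> b) / ((x - y) \<bullet> a)) *\<^sub>R a + b) < top"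
      by (auto simp: p_def q_def Z_def less_top split: prod.splits)
  qed
qed

section \<open>Frostman measures and radial directions in the plane\<close>

lemma ennreal_le_suminf: "f n \<le> suminf f" for f :: "nat \<Rightarrow> ennreal"
  using sum_le_suminf[of f "{n}"] by simp

lemma ennreal_top_if_unbounded:
  assumes "\<And>n. ennreal (real n) \<le> a"
  shows "a = top"
proof (rule ccontr)
  assume "a \<noteq> top"
  then obtain n where "a < of_nat n"
    using ennreal_Ex_less_of_nat[of a] by (auto simp: less_top)
  then show False
    using assms[of n] by (simp add: ennreal_of_nat_eq_real_of_nat)
qed

text \<open>On the diagonal both sides are infinite: \<open>inverse 0 = top\<close> in \<^typ>\<open>ennreal\<close>.\<close>
lemma inverse_norm_le_dyadic_sum:
  "inverse (ennreal (norm (x - y))) \<le> 1 + (\<Sum>n. 2 ^ Suc n * indicator (ball x (1 / 2 ^ n)) y)"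
    (is "_ \<le> 1 + suminf ?f")
proof -
  have f_le: "?f n \<le> suminf ?f" for n
    by (rule ennreal_le_suminf)
  consider "x = y" | "x \<noteq> y" "1 \<le> norm (x - y)" | "x \<noteq> y" "norm (x - y) < 1" by linarith
  then show ?thesis
  proof cases
    case 1
    have "ennreal (real n) \<le> suminf ?f" for n
    proof -
      have "real n \<le> 2 ^ Suc n" using of_nat_less_two_power[of n, where 'a=real] of_nat_0_le_iff[of n, where 'a=real]
        unfolding power_Suc by linarith
      then have "ennreal (real n) \<le> ?f n"
        using 1 by (simp add: ennreal_power2_eq ennreal_leI del: power_Suc)
      then show ?thesis using f_le[of n] by simp
    qed
    then have "suminf ?f = top"
      by (rule ennreal_top_if_unbounded)
    then show ?thesis by simp
  next
    case 2
    then have "inverse (ennreal (norm (x - y))) \<le> 1"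
      by (simp add: inverse_ennreal inverse_le_1_iff)
    then show ?thesis by (rule order_trans) simp
  next
    case 3
    let ?r = "norm (x - y)"
    have r: "0 < ?r" using 3 by simp
    \<comment> \<open>The least scale below \<open>?r\<close> is positive because
      \<open>?r < 1\<close>. At the preceding scale m the point y is still in the ball, and the
      factor \<open>2 ^ Suc m\<close> is at least \<open>inverse ?r\<close>.\<close>
    define n where "n = (LEAST n. 1 / 2 ^ n \<le> ?r)"
    obtain k where k: "1 / 2 ^ k < ?r"
      using eventually_happens[OF eventually_less_inverse_power2[OF r]] by auto
    have n: "1 / 2 ^ n \<le> ?r" unfolding n_def by (rule LeastI[of "\<lambda>n. 1 / 2 ^ n \<le> ?r" k]) (use k in simp)
    then obtain m where m: "n = Suc m" using 3 by (cases n) auto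
    have "m < n" using m by simp
    then have "\<not> 1 / 2 ^ m \<le> ?r" unfolding n_def by (rule not_less_Least)
    then have "y \<in> ball x (1 / 2 ^ m)" by (simp add: dist_norm)
    then have "?f m = ennreal (2 ^ Suc m)"
      unfolding ennreal_power2_eq by simp
    moreover have "inverse ?r \<le> 2 ^ Suc m"
      using n r unfolding m by (simp add: field_simps)
    ultimately have "inverse (ennreal ?r) \<le> ?f m"
      using r by (simp add: inverse_ennreal ennreal_leI del: power_Suc)
    then have "inverse (ennreal ?r) \<le> suminf ?f"
      using f_le[of m] by (rule order_trans)
    then show ?thesis by (rule add_increasing[rotated]) simp
  qed
qed

text \<open>The dyadic majorant of the kernel bounds the potential at every x by the total mass plus
  a geometric series of ratio \<open>2 powr (1 - \<alpha>)\<close>, convergent because \<alpha> > 1.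
  Integrating a bounded potential against a finite measure gives a finite energy.\<close>

lemma riesz_energy_finite:
  fixes M :: "'a::euclidean_space measure"
  assumes fin: "finite_measure M" and [measurable_cong]: "sets M = sets borel"
    and C: "\<And>x r. 0 < r \<Longrightarrow> measure M (ball x r) \<le> C * r powr \<alpha>" and "1 < \<alpha>"
  shows "riesz_energy M < top"
proof -
  interpret finite_measure M by fact
  have [measurable]: "Measurable.pred borel (\<lambda>y. y \<in> ball x r)" for x :: 'a and r
    unfolding mem_ball by measurable
  let ?q = "2 powr (1 - \<alpha>)"
  have q: "0 < ?q" "?q < 1" using \<open>1 < \<alpha>\<close> by (auto simp: powr_less_one)
  \<comment> \<open>Follows from the unit ball at the origin, whose measure is nonnegative.\<close>
  have "0 \<le> C" using order_trans[OF measure_nonneg C[of 1 0]] by simp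
  define S where "S = (\<Sum>n. 2 * C * ?q ^ n)"
  have summ: "summable (\<lambda>n. 2 * C * ?q ^ n)"
    using q by (intro summable_mult summable_geometric) auto
  define K where "K = emeasure M (space M) + ennreal S"
  have "(\<integral>\<^sup>+y. inverse (ennreal (norm (x - y))) \<partial>M) \<le> K" for x
  proof -
    have "(\<integral>\<^sup>+y. inverse (ennreal (norm (x - y))) \<partial>M)
        \<le> (\<integral>\<^sup>+y. 1 + (\<Sum>n. 2 ^ Suc n * indicator (ball x (1 / 2 ^ n)) y) \<partial>M)"
      by (intro nn_integral_mono inverse_norm_le_dyadic_sum)
    also have "\<dots> = emeasure M (space M) + (\<Sum>n. 2 ^ Suc n * emeasure M (ball x (1 / 2 ^ n)))"
    proof -
      have "(\<integral>\<^sup>+y. 1 + (\<Sum>n. 2 ^ Suc n * indicator (ball x (1 / 2 ^ n)) y) \<partial>M)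
          = (\<integral>\<^sup>+y. 1 \<partial>M) + (\<integral>\<^sup>+y. (\<Sum>n. 2 ^ Suc n * indicator (ball x (1 / 2 ^ n)) y) \<partial>M)"
        by (rule nn_integral_add) measurable
      also have "(\<integral>\<^sup>+y. 1 \<partial>M) = emeasure M (space M)" by simp
      also have "(\<integral>\<^sup>+y. (\<Sum>n. 2 ^ Suc n * indicator (ball x (1 / 2 ^ n)) y) \<partial>M)
          = (\<Sum>n. \<integral>\<^sup>+y. 2 ^ Suc n * indicator (ball x (1 / 2 ^ n)) y \<partial>M)"
        by (rule nn_integral_suminf) measurable
      also have "\<dots> = (\<Sum>n. 2 ^ Suc n * emeasure M (ball x (1 / 2 ^ n)))"
        by (intro suminf_cong nn_integral_cmult_indicator) measurable
      finally show ?thesis .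
    qed
    also have "(\<Sum>n. 2 ^ Suc n * emeasure M (ball x (1 / 2 ^ n))) \<le> (\<Sum>n. ennreal (2 * C * ?q ^ n))"
    proof (intro suminf_le summableI)
      fix n :: nat
      have "(2::real) ^ Suc n * measure M (ball x (1 / 2 ^ n)) \<le> 2 ^ Suc n * (C * (1 / 2 ^ n) powr \<alpha>)"
        by (intro mult_left_mono C) auto
      also have e: "(1 / 2 ^ n :: real) = 2 powr (- real n)"
        by (simp add: powr_minus powr_realpow divide_inverse)
      also have "2 ^ Suc n * (C * (2 powr (- real n)) powr \<alpha>) = 2 * C * (2 powr real n * (2 powr (- real n * \<alpha>)))"
        by (simp add: powr_powr powr_realpow)
      also have "2 powr real n * (2 powr (- real n * \<alpha>)) = ?q ^ n"
        by (simp add: powr_add[symmetric] powr_realpow[symmetric] powr_powr algebra_simps)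
      finally show "2 ^ Suc n * emeasure M (ball x (1 / 2 ^ n)) \<le> ennreal (2 * C * ?q ^ n)"
        unfolding e
        by (simp add: emeasure_eq_measure ennreal_power2_eq ennreal_mult'[symmetric] ennreal_leI del: power_Suc)
    qed
    also have "\<dots> = ennreal S"
      unfolding S_def using q \<open>0 \<le> C\<close> by (intro suminf_ennreal2 summ) auto
    finally show ?thesis by (simp add: K_def add_left_mono)
  qed
  then have "riesz_energy M \<le> (\<integral>\<^sup>+x. K \<partial>M)"
    unfolding riesz_energy_def by (intro nn_integral_mono) auto
  also have "\<dots> < top"
    by (simp add: K_def ennreal_mult_less_top ennreal_mult_eq_top_iff ennreal_add_eq_top less_top[symmetric] emeasure_eq_measure)
  finally show ?thesis .
qed

lemma frostman_riesz_energy_finite: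
  assumes "frostman_measure \<alpha> E M" "1 < \<alpha>"
  shows "riesz_energy M < top"
proof -
  obtain C where "\<And>x r. 0 < r \<Longrightarrow> measure M (ball x r) \<le> C * r powr \<alpha>"
    using assms(1) unfolding frostman_measure_def by blast
  then show ?thesis
    using assms by (intro riesz_energy_finite) (auto simp: frostman_measure_def)
qed

section \<open>Directions determined by pairs of points, and measurability of the good pairs\<close>

lemma measure_in_L2_proj_iff:
  assumes "sets M = sets borel" "finite_measure M"
  shows "measure_in_L2 (proj_measure M v) \<longleftrightarrow> proj_energy M v < top"
  unfolding proj_energy_def by (intro measure_in_L2_iff finite_proj_measure assms) simp

text \<open>Links the unit vectors of the radial projection to the unnormalised directions
  \<open>s *\<^sub>R a + b\<close> of the energy estimates.\<close>

lemma measure_in_L2_proj_scale: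
  fixes M :: "'a::euclidean_space measure"
  assumes [measurable_cong]: "sets M = sets borel" and "measure_in_L2 (proj_measure M v)" "c \<noteq> 0"
  shows "measure_in_L2 (proj_measure M (c *\<^sub>R v))"
proof -
  have "proj_measure M (c *\<^sub>R v) = distr (proj_measure M v) borel (\<lambda>t. c * t)"
    unfolding proj_measure_def by (subst distr_distr) (auto simp: o_def)
  then show ?thesis using measure_in_L2_scale[OF assms(2,3)] by simp
qed

lemma rot90_radial_proj:
  "rot90 (radial_proj x y) = (1 / norm (y - x)) *\<^sub>R vector [- (y - x) $ 2, (y - x) $ 1]"
  unfolding rot90_def radial_proj_def by (simp add: vec_eq_iff forall_2 diff_divide_distrib)

lemma norm_le_abs_coordinates:
  fixes z :: "real^2"
  shows "norm z \<le> \<bar>z \<bullet> axis 1 1\<bar> + \<bar>z \<bullet> axis 2 1\<bar>" "norm z \<le> \<bar>z \<bullet> axis 2 1\<bar> + \<bar>z \<bullet> axis 1 1\<bar>"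
  using norm_le_l1_cart[of z] by (auto simp: inner_axis sum_2)

text \<open>Dividing by the coordinate of \<open>x - y\<close> of larger absolute value gives a
  slope of absolute value at most 1, well inside the parameter interval.\<close>

lemma rot90_radial_proj_chart:
  assumes "x \<noteq> y"
  obtains c s where "c \<noteq> 0" "s \<in> {-2<..<2}" "(x - y) \<bullet> axis 1 1 \<noteq> 0"
      "s = - ((x - y) \<bullet> axis 2 1) / ((x - y) \<bullet> axis 1 1)"
      "rot90 (radial_proj x y) = c *\<^sub>R (s *\<^sub>R axis 1 1 + axis 2 1)"
  | c s where "c \<noteq> 0" "s \<in> {-2<..<2}" "(x - y) \<bullet> axis 2 1 \<noteq> 0"
      "s = - ((x - y) \<bullet> axis 1 1) / ((x - y) \<bullet> axis 2 1)"
      "rot90 (radial_proj x y) = c *\<^sub>R (s *\<^sub>R axis 2 1 + axis 1 1)"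
proof -
  let ?r = "norm (y - x)" and ?p = "x $ 1 - y $ 1" and ?q = "x $ 2 - y $ 2"
  have r: "?r > 0" using assms by simp
  have pq: "?p \<noteq> 0 \<or> ?q \<noteq> 0" using assms by (auto simp: vec_eq_iff forall_2)
  have ax: "axis (1::2) (1::real) $ 1 = 1" "axis (1::2) (1::real) $ 2 = 0"
      "axis (2::2) (1::real) $ 1 = 0" "axis (2::2) (1::real) $ 2 = 1"
    by (simp_all add: axis_def)
  show thesis
  proof (cases "\<bar>?q\<bar> \<le> \<bar>?p\<bar>")
    case True
    then have p: "?p \<noteq> 0" using pq by auto
    have "\<bar>- ?q / ?p\<bar> \<le> 1" using True p by (simp add: field_simps)
    then have s: "- ?q / ?p \<in> {-2<..<2}"
      unfolding greaterThanLessThan_iff by linarith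
    show thesis
      \<comment> \<open>The rotated direction is \<open>(?q, - ?p)\<close> divided by
        \<open>?r\<close>; the scalar is its coordinate along the vector that carries coefficient 1
        in the chart.\<close>
      by (rule that(1)[OF _ s, of "- ?p / ?r"])
        (use p r in \<open>auto simp: inner_axis rot90_radial_proj vec_eq_iff forall_2 ax field_simps\<close>)
  next
    case False
    then have q: "?q \<noteq> 0" by auto
    have "\<bar>- ?p / ?q\<bar> \<le> 1" using False q by (simp add: field_simps)
    then have s: "- ?p / ?q \<in> {-2<..<2}"
      unfolding greaterThanLessThan_iff by linarith
    show thesis
      by (rule that(2)[OF _ s, of "?q / ?r"])
        (use q r in \<open>auto simp: inner_axis rot90_radial_proj vec_eq_iff forall_2 ax field_simps\<close>)
  qed
qed

text \<open>Coordinates are written as inner products with basis vectors. On the diagonal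
  \<open>1 / 0 = 0\<close> makes the direction 0, so the formula is Borel everywhere.\<close>

lemma measurable_rot90_radial_proj [measurable]:
  "(\<lambda>w. rot90 (radial_proj (fst w) (snd w))) \<in> borel_measurable borel"
proof -
  have [measurable]: "fst \<in> borel_measurable (borel :: ((real^2) \<times> (real^2)) measure)"
      "snd \<in> borel_measurable (borel :: ((real^2) \<times> (real^2)) measure)"
    by (intro borel_measurable_continuous_onI continuous_intros)+
  have "rot90 (radial_proj (fst w) (snd w)) = (1 / norm (snd w - fst w)) *\<^sub>R
      ((- (snd w - fst w) $ 2) *\<^sub>R axis 1 1 + ((snd w - fst w) $ 1) *\<^sub>R axis 2 1)" for w
    unfolding rot90_radial_proj by (simp add: vec_eq_iff forall_2 axis_def)
  moreover have "(\<lambda>w::(real^2) \<times> (real^2). (1 / norm (snd w - fst w)) *\<^sub>R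
      ((- (snd w - fst w) $ 2) *\<^sub>R axis 1 1 + ((snd w - fst w) $ 1) *\<^sub>R (axis 2 1 :: real^2)))
      \<in> borel_measurable borel"
    unfolding cart_eq_inner_axis by measurable
  ultimately show ?thesis by simp
qed

lemma good_pairs_eq:
  assumes "sets M = sets borel" "finite_measure M"
  shows "good_pairs A B M = (A \<times> B) \<inter> {w. proj_energy M (rot90 (radial_proj (fst w) (snd w))) < top}"
  unfolding good_pairs_def measure_in_L2_proj_iff[OF assms, symmetric] proj_measure_def lin_proj_def
  by auto

text \<open>Needed because \<open>emeasure\<close> is 0 on non-measurable sets. The good pairs are
  cut out of a rectangle by a Borel function of the direction, and the product of the Borel algebras
  is the Borel algebra of the product.\<close>

lemma sets_good_pairs:
  assumes [measurable_cong]: "sets M = sets borel" "sets N = sets borel"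
    and P: "sets P = sets borel" "finite_measure P"
    and [measurable]: "A \<in> sets borel" "B \<in> sets borel"
  shows "good_pairs A B P \<in> sets (M \<Otimes>\<^sub>M N)"
proof -
  note [measurable] = measurable_proj_energy[OF P]
  have "sets (M \<Otimes>\<^sub>M N) = sets (borel :: ((real^2) \<times> (real^2)) measure)"
    unfolding borel_prod[symmetric] by (rule sets_pair_measure_cong; fact)
  moreover have "A \<times> B \<in> sets borel"
    unfolding borel_prod[symmetric] by measurable
  ultimately show ?thesis
    unfolding good_pairs_eq[OF P] by simp
qed

text \<open>The slope result is used for both orders of the coordinate vectors; each pair off the
  diagonal is covered by one of the two charts.\<close>

lemma AE_measure_in_L2_radial_proj:
  fixes M N P :: "(real^2) measure"
  assumes sets: "sets M = sets borel" "sets N = sets borel" "sets P = sets borel"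
    and fin: "finite_measure M" "finite_measure N" "finite_measure P"
    and riesz: "riesz_energy M < top" "riesz_energy N < top" "riesz_energy P < top"
  shows "AE (x, y) in M \<Otimes>\<^sub>M N. x \<noteq> y \<longrightarrow> measure_in_L2 (proj_measure P (rot90 (radial_proj x y)))"
  using AE_proj_energy_slope_finite[OF sets(1,2) fin(1,2) sets(3) fin(3) norm_le_abs_coordinates(1) riesz]
    AE_proj_energy_slope_finite[OF sets(1,2) fin(1,2) sets(3) fin(3) norm_le_abs_coordinates(2) riesz]
proof eventually_elim
  case (elim w)
  obtain x y where w: "w = (x, y)" by (rule prod.exhaust)
  note h = elim[unfolded w prod.case]
  have "measure_in_L2 (proj_measure P (rot90 (radial_proj x y)))" if "x \<noteq> y"
    using that
  proof (cases rule: rot90_radial_proj_chart)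
    case (1 c s)
    have "proj_energy P (s *\<^sub>R axis 1 1 + axis 2 1) < top"
      using h(1) 1(2,3) unfolding 1(4) by blast
    then show ?thesis
      unfolding 1(5) measure_in_L2_proj_iff[OF sets(3) fin(3), symmetric]
      by (rule measure_in_L2_proj_scale[OF sets(3) _ 1(1)])
  next
    case (2 c s)
    have "proj_energy P (s *\<^sub>R axis 2 1 + axis 1 1) < top"
      using h(2) 2(2,3) unfolding 2(4) by blast
    then show ?thesis
      unfolding 2(5) measure_in_L2_proj_iff[OF sets(3) fin(3), symmetric]
      by (rule measure_in_L2_proj_scale[OF sets(3) _ 2(1)])
  qed
  then show ?case unfolding w prod.case by (rule impI)
qed

section \<open>Removal of the diagonal, and positivity of the product mass\<close>

lemma AE_mem_good_pairs:
  assumes "AE (x, y) in M. x \<noteq> y \<longrightarrow> measure_in_L2 (proj_measure P (rot90 (radial_proj x y)))"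
    and "A \<inter> B = {}"
  shows "AE w in M. w \<in> good_pairs A B P \<longleftrightarrow> w \<in> A \<times> B"
  using assms(1)
proof eventually_elim
  case (elim w)
  obtain x y where w: "w = (x, y)" by (rule prod.exhaust)
  have "measure_in_L2 (distr P borel (lin_proj (rot90 (radial_proj x y))))" if "x \<in> A" "y \<in> B"
    using elim that assms(2) unfolding w prod.case proj_measure_def lin_proj_def[abs_def] by blast
  then show ?case unfolding w good_pairs_def by blast
qed

lemma separated_sets_disjoint:
  assumes "separated_sets A B"
  shows "A \<inter> B = {}"
proof (rule ccontr)
  assume "A \<inter> B \<noteq> {}"
  then obtain x where "x \<in> A" "x \<in> B" by blast
  then show False
    using setdist_le_dist[of x A x B] assms unfolding separated_sets_def by simp
qed

lemma emeasure_frostman_support_pos: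
  assumes "frostman_measure \<alpha> E M" "E \<in> sets borel"
  shows "emeasure M E > 0"
proof -
  have *: "sets M = sets borel" "emeasure M UNIV > 0" "emeasure M (UNIV - E) = 0"
    using assms(1) unfolding frostman_measure_def by blast+
  have "emeasure M UNIV \<le> emeasure M E + emeasure M (UNIV - E)"
    using emeasure_subadditive[of E M "UNIV - E"] assms(2) * by simp
  then show ?thesis using * by simp
qed

lemma emeasure_pair_pos:
  assumes "finite_measure N" "A \<in> sets M" "B \<in> sets N" "emeasure M A > 0" "emeasure N B > 0"
  shows "emeasure (M \<Otimes>\<^sub>M N) (A \<times> B) > 0"
proof -
  interpret N: finite_measure N by fact
  show ?thesis
    using assms(2-) by (simp add: N.emeasure_pair_measure_Times ennreal_zero_less_mult_iff)
qed

theorem theorem4p3: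
  fixes \<alpha> :: real
    and E1 E2 E3 :: "(real^2) set"
    and \<mu>1 \<mu>2 \<mu>3 :: "(real^2) measure"
  assumes "\<alpha> > 1"
    and "compact E1" and "compact E2" and "compact E3"
    and "separated_sets E1 E2" and "separated_sets E1 E3" and "separated_sets E2 E3"
    and "frostman_measure \<alpha> E1 \<mu>1"
    and "frostman_measure \<alpha> E2 \<mu>2"
    and "frostman_measure \<alpha> E3 \<mu>3"
  shows "emeasure (\<mu>1 \<Otimes>\<^sub>M \<mu>2) (good_pairs E1 E2 \<mu>3) > 0 \<and>
         emeasure (\<mu>1 \<Otimes>\<^sub>M \<mu>2) (good_pairs E1 E2 \<mu>3) = emeasure (\<mu>1 \<Otimes>\<^sub>M \<mu>2) (E1 \<times> E2)"
proof -
  note sets = assms(8-10)[unfolded frostman_measure_def, THEN conjunct1]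
  note fin = assms(8-10)[unfolded frostman_measure_def, THEN conjunct2, THEN conjunct1]
  note riesz = assms(8-10)[THEN frostman_riesz_energy_finite, OF assms(1)]
  note E = assms(2,3)[THEN borel_compact]
  have E': "E1 \<in> sets \<mu>1" "E2 \<in> sets \<mu>2" unfolding sets by (fact E)+
  have "emeasure (\<mu>1 \<Otimes>\<^sub>M \<mu>2) (good_pairs E1 E2 \<mu>3) = emeasure (\<mu>1 \<Otimes>\<^sub>M \<mu>2) (E1 \<times> E2)"
  proof (rule emeasure_eq_AE)
    show "AE w in \<mu>1 \<Otimes>\<^sub>M \<mu>2. w \<in> good_pairs E1 E2 \<mu>3 \<longleftrightarrow> w \<in> E1 \<times> E2"
      by (rule AE_mem_good_pairs[OF AE_measure_in_L2_radial_proj[OF sets fin riesz]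
            separated_sets_disjoint[OF assms(5)]])
    show "good_pairs E1 E2 \<mu>3 \<in> sets (\<mu>1 \<Otimes>\<^sub>M \<mu>2)"
      by (rule sets_good_pairs[OF sets fin(3) E])
    show "E1 \<times> E2 \<in> sets (\<mu>1 \<Otimes>\<^sub>M \<mu>2)"
      by (rule pair_measureI[OF E'])
  qed
  moreover have "emeasure (\<mu>1 \<Otimes>\<^sub>M \<mu>2) (E1 \<times> E2) > 0"
    by (rule emeasure_pair_pos[OF fin(2) E' emeasure_frostman_support_pos[OF assms(8) E(1)]
          emeasure_frostman_support_pos[OF assms(9) E(2)]])
  ultimately show ?thesis by simp
qed

end
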